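(* Let $1<p<\infty$ and $1<q<\infty$ be such that $p^{-1}+q^{-1}=1$, and let $-\infty<a<b<\infty$. For a bounded linear functional $L:\mathcal W_q[a,b]\to\mathbb R$ let $T(L)(t):=L(\mathbf 1_{[a,t]})$ for each $t\in[a,b]$. Then $T$ is a linear mapping from the dual space $\mathcal W_q^*[a,b]$ into $\mathcal W_p[a,b]$, and $$\|T(L)\|_{[p]}\le 5\|L\|_{\mathcal F_q},\qquad L\in\mathcal W_q^*[a,b].$$
   Context: For $0<r<\infty$ and $g:[a,b]\to\mathbb R$, $v_r(g;[a,b])=\sup\{\sum_{i=1}^m|g(t_i)-g(t_{i-1})|^r:a=t_0<t_1<\dots<t_m=b,\ m\ge1\}$. For $1\le r<\infty$, $\mathcal W_r[a,b]$ is the Banach space of functions $g:[a,b]\to\mathbb R$ with $v_r(g;[a,b])<\infty$, with norm $\|g\|_{[r]}=\sup_{t\in[a,b]}|g(t)|+v_r(g;[a,b])^{1/r}$. $\mathcal F_q=\{f\in\mathcal W_q[a,b]:\|f\|_{[q]}\le1\}$ is its unit ball (for $r=q$), and $\|L\|_{\mathcal F_q}=\sup\{|L(f)|:f\in\mathcal F_q\}$. $\mathbf 1_{[a,t]}$ is the indicator function of $[a,t]$. *)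

theory Defs
  imports "HOL-Analysis.Analysis"
begin

text \<open>
  A function on \<open>[a, b]\<close> is represented by its extension by zero to the whole real line, so that the
  function spaces below are genuine linear subspaces of \<^typ>\<open>real \<Rightarrow> real\<close>.  Likewise a functional on
  such a space is represented by its extension by zero to all of \<^typ>\<open>real \<Rightarrow> real\<close>.
\<close>

definition partition_points :: "real \<Rightarrow> real \<Rightarrow> nat \<Rightarrow> (nat \<Rightarrow> real) \<Rightarrow> bool" where
  "partition_points a b m t \<longleftrightarrow> m \<ge> 1 \<and> t 0 = a \<and> t m = b \<and> (\<forall>i\<in>{1..m}. t (i - 1) < t i)"

text \<open>The \<open>r\<close>-variation takes values in \<^typ>\<open>ennreal\<close>, as the supremum may be infinite.\<close>

definition r_variation :: "real \<Rightarrow> (real \<Rightarrow> real) \<Rightarrow> real \<Rightarrow> real \<Rightarrow> ennreal" where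
  "r_variation r g a b =
     Sup {ennreal (\<Sum>i=1..m. \<bar>g (t i) - g (t (i - 1))\<bar> powr r) | m t. partition_points a b m t}"

definition W_space :: "real \<Rightarrow> real \<Rightarrow> real \<Rightarrow> (real \<Rightarrow> real) set" where
  "W_space r a b = {g. (\<forall>x. x \<notin> {a..b} \<longrightarrow> g x = 0) \<and> r_variation r g a b < \<infinity>}"

text \<open>Meaningful on \<open>W_space r a b\<close> only: there the variation is finite, hence \<open>g\<close> is bounded and the
  real supremum is the true one.\<close>

definition W_norm :: "real \<Rightarrow> real \<Rightarrow> real \<Rightarrow> (real \<Rightarrow> real) \<Rightarrow> real" where
  "W_norm r a b g =
     (SUP t\<in>{a..b}. \<bar>g t\<bar>) + enn2real (r_variation r g a b) powr (1 / r)"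

definition W_unit_ball :: "real \<Rightarrow> real \<Rightarrow> real \<Rightarrow> (real \<Rightarrow> real) set" where
  "W_unit_ball r a b = {f \<in> W_space r a b. W_norm r a b f \<le> 1}"

definition W_dual :: "real \<Rightarrow> real \<Rightarrow> real \<Rightarrow> ((real \<Rightarrow> real) \<Rightarrow> real) set" where
  "W_dual r a b = {L.
     (\<forall>f. f \<notin> W_space r a b \<longrightarrow> L f = 0) \<and>
     (\<forall>f\<in>W_space r a b. \<forall>g\<in>W_space r a b. L (\<lambda>x. f x + g x) = L f + L g) \<and>
     (\<forall>c. \<forall>f\<in>W_space r a b. L (\<lambda>x. c * f x) = c * L f) \<and>
     (\<exists>C. \<forall>f\<in>W_space r a b. \<bar>L f\<bar> \<le> C * W_norm r a b f)}"

text \<open>For \<open>L\<close> in \<open>W_dual r a b\<close> the values below are bounded, so the real supremum is the true one.\<close>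

definition W_dual_norm :: "real \<Rightarrow> real \<Rightarrow> real \<Rightarrow> ((real \<Rightarrow> real) \<Rightarrow> real) \<Rightarrow> real" where
  "W_dual_norm r a b L = (SUP f\<in>W_unit_ball r a b. \<bar>L f\<bar>)"

definition T_map :: "real \<Rightarrow> real \<Rightarrow> ((real \<Rightarrow> real) \<Rightarrow> real) \<Rightarrow> real \<Rightarrow> real" where
  "T_map a b L = (\<lambda>t. if t \<in> {a..b} then L (indicat_real {a..t}) else 0)"

end

theory Submission
  imports Defs
begin

text \<open>
  For a partition \<open>a = t\<^sub>0 < \<dots> < t\<^sub>m = b\<close> the increments of \<open>T(L)\<close> are \<open>d\<^sub>i = L(\<one>\<^bsub>(t\<^sub>i\<^sub>-\<^sub>1, t\<^sub>i]\<^esub>)\<close>.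
  Testing \<open>L\<close> on the step function \<open>f\<close> with the value \<open>c\<^sub>i = sgn d\<^sub>i \<bar>d\<^sub>i\<bar>\<^sup>p\<^sup>-\<^sup>1\<close> on \<open>(t\<^sub>i\<^sub>-\<^sub>1, t\<^sub>i]\<close> gives
  \<open>S = \<Sum> \<bar>d\<^sub>i\<bar>\<^sup>p = L(f) \<le> \<parallel>L\<parallel> \<parallel>f\<parallel>\<close>.  A sum of \<open>q\<close>-th powers of increments of \<open>f\<close> meets each step
  at most twice, so by convexity \<open>v\<^sub>q(f) \<le> 2\<^sup>q \<Sum> \<bar>c\<^sub>i\<bar>\<^sup>q = 2\<^sup>q S\<close>, and the norm of \<open>f\<close> is at most
  \<open>(1 + 2) S\<^sup>1\<^sup>/\<^sup>q\<close>.  Hence \<open>S\<^sup>1\<^sup>/\<^sup>p \<le> 3 \<parallel>L\<parallel>\<close>; the supremum of \<open>T(L)\<close> contributes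
  the remaining \<open>2 \<parallel>L\<parallel>\<close>.
\<close>

section \<open>Convexity and sums of powers of increments\<close>

text \<open>Midpoint convexity of \<open>z powr q\<close> at \<open>\<bar>x\<bar>\<close> and
  \<open>\<bar>y\<bar>\<close>, multiplied by \<open>2 powr q\<close>.\<close>

lemma abs_diff_powr_le:
  fixes x y q :: real
  assumes "1 \<le> q"
  shows "\<bar>x - y\<bar> powr q \<le> 2 powr (q - 1) * (\<bar>x\<bar> powr q + \<bar>y\<bar> powr q)"
proof -
  have *: "((\<bar>x\<bar> + \<bar>y\<bar>) / 2) powr q \<le> (\<bar>x\<bar> powr q + \<bar>y\<bar> powr q) / 2"
  \<comment> \<open>Convexity is applied at positive arguments only; if one argument vanishes, the
    claim reduces to \<open>(1 / 2) powr q \<le> 1 / 2\<close>.\<close>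
  proof (cases "x = 0 \<or> y = 0")
    case True
    have "(1 / 2 :: real) powr q \<le> (1 / 2) powr 1"
      using assms by (intro powr_mono') auto
    then have "(\<bar>z\<bar> / 2) powr q \<le> \<bar>z\<bar> powr q / 2" for z :: real
      using mult_left_mono[of "(1 / 2) powr q" "1 / 2" "\<bar>z\<bar> powr q"]
      by (simp add: powr_divide)
    with True show ?thesis by auto
  next
    case False
    then have "((1 - 1/2) *\<^sub>R \<bar>x\<bar> + (1/2) *\<^sub>R \<bar>y\<bar>) powr q
        \<le> (1 - 1/2) * \<bar>x\<bar> powr q + 1/2 * \<bar>y\<bar> powr q"
      by (intro convex_onD[OF powr_convex[OF assms]]) auto
    then show ?thesis
      by (simp add: add_divide_distrib)
  qed
  have "\<bar>x - y\<bar> powr q \<le> (\<bar>x\<bar> + \<bar>y\<bar>) powr q"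
    using assms by (intro powr_mono2) auto
  also have "\<dots> = 2 powr q * ((\<bar>x\<bar> + \<bar>y\<bar>) / 2) powr q"
    by (simp add: powr_divide)
  also have "\<dots> \<le> 2 powr q * ((\<bar>x\<bar> powr q + \<bar>y\<bar> powr q) / 2)"
    using * by (intro mult_left_mono) auto
  finally show ?thesis
    by (simp add: powr_diff)
qed

text \<open>Here \<open>c\<close> lists the values of a step function and \<open>k j\<close> is the
  step containing the \<open>j\<close>-th point. Each step is entered and left at most once, so each
  \<open>c i\<close> occurs at most twice, which turns the convexity factor
  \<open>2 powr (q - 1)\<close> into \<open>2 powr q\<close>.\<close>

lemma sum_powr_increments_le:
  fixes k :: "nat \<Rightarrow> nat" and c :: "nat \<Rightarrow> real" and q :: real
  assumes "1 \<le> q" and mono: "\<And>i j. i \<le> j \<Longrightarrow> j \<le> n \<Longrightarrow> k i \<le> k j" and "k n \<le> m"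
  shows "(\<Sum>j=1..n. \<bar>c (k j) - c (k (j - 1))\<bar> powr q) \<le> 2 powr q * (\<Sum>i\<le>m. \<bar>c i\<bar> powr q)"
proof -
  \<comment> \<open>Increments inside one step vanish; once they are dropped, \<open>k\<close>
    becomes injective.\<close>
  define J where "J = {j \<in> {1..n}. k j \<noteq> k (j - 1)}"
  have step: "k (j - 1) < k j" if "j \<in> J" for j
    using that mono[of "j - 1" j] by (force simp: J_def)
  \<comment> \<open>With \<open>step\<close>, this gives the chain
    \<open>k (i - 1) < k i \<le> k (j - 1) < k j\<close>, hence injectivity of both index
    maps.\<close>
  have sep: "k i \<le> k (j - 1)" if "i \<in> J" "j \<in> J" "i < j" for i j
    using that by (intro mono) (auto simp: J_def)
  have inj: "inj_on k J"
    by (rule linorder_inj_onI') (use sep step in fastforce)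
  have inj': "inj_on (\<lambda>j. k (j - 1)) J"
    by (rule linorder_inj_onI') (use sep step in fastforce)
  have bound: "k j \<le> m" if "j \<le> n" for j
    using mono[of j n] that assms(3) by simp
  have le: "(\<Sum>j\<in>J. \<bar>c (h j)\<bar> powr q) \<le> (\<Sum>i\<le>m. \<bar>c i\<bar> powr q)"
    if "inj_on h J" "h ` J \<subseteq> {..m}" for h
  proof -
    have "(\<Sum>j\<in>J. \<bar>c (h j)\<bar> powr q) = (\<Sum>i\<in>h ` J. \<bar>c i\<bar> powr q)"
      using that by (simp add: sum.reindex)
    also have "\<dots> \<le> (\<Sum>i\<le>m. \<bar>c i\<bar> powr q)"
      using that by (intro sum_mono2) auto
    finally show ?thesis .
  qed
  have "(\<Sum>j=1..n. \<bar>c (k j) - c (k (j - 1))\<bar> powr q) = (\<Sum>j\<in>J. \<bar>c (k j) - c (k (j - 1))\<bar> powr q)"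
    by (rule sum.mono_neutral_right) (auto simp: J_def)
  also have "\<dots> \<le> (\<Sum>j\<in>J. 2 powr (q - 1) * (\<bar>c (k j)\<bar> powr q + \<bar>c (k (j - 1))\<bar> powr q))"
    by (intro sum_mono abs_diff_powr_le assms)
  also have "\<dots> = 2 powr (q - 1) *
      ((\<Sum>j\<in>J. \<bar>c (k j)\<bar> powr q) + (\<Sum>j\<in>J. \<bar>c (k (j - 1))\<bar> powr q))"
    by (simp add: sum.distrib sum_distrib_left distrib_left)
  also have "\<dots> \<le> 2 powr (q - 1) * ((\<Sum>i\<le>m. \<bar>c i\<bar> powr q) + (\<Sum>i\<le>m. \<bar>c i\<bar> powr q))"
    using inj inj' by (intro mult_left_mono add_mono le) (auto simp: J_def intro!: bound)
  finally show ?thesis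
    by (simp add: powr_diff)
qed

section \<open>Partitions and functions of finite variation\<close>

lemma partition_points_mono:
  assumes "partition_points a b m t" "i \<le> j" "j \<le> m"
  shows "t i \<le> t j"
  using assms(2,3)
proof (induction j rule: dec_induct)
  case (step n)
  then have "t n < t (Suc n)"
    using assms(1) by (auto simp: partition_points_def dest!: bspec[of _ _ "Suc n"])
  with step show ?case by simp
qed simp

lemma partition_points_in:
  assumes "partition_points a b m t" "i \<le> m"
  shows "t i \<in> {a..b}"
proof -
  have "t 0 = a" "t m = b"
    using assms(1) by (simp_all add: partition_points_def)
  then show ?thesis
    using partition_points_mono[OF assms(1), of 0 i] partition_points_mono[OF assms(1), of i m] assms(2)
    by simp
qed

lemma r_variation_le:
  assumes "\<And>m t. partition_points a b m t \<Longrightarrow> (\<Sum>i=1..m. \<bar>g (t i) - g (t (i - 1))\<bar> powr r) \<le> V"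
  shows "r_variation r g a b \<le> ennreal V"
  unfolding r_variation_def using assms by (intro Sup_least) (auto intro!: ennreal_leI)

lemma W_spaceI:
  assumes "\<And>x. x \<notin> {a..b} \<Longrightarrow> g x = 0"
    and "\<And>m t. partition_points a b m t \<Longrightarrow> (\<Sum>i=1..m. \<bar>g (t i) - g (t (i - 1))\<bar> powr r) \<le> V"
  shows "g \<in> W_space r a b"
proof -
  have "r_variation r g a b \<le> ennreal V"
    by (intro r_variation_le assms(2))
  then have "r_variation r g a b < \<infinity>"
    by (rule le_less_trans) simp
  then show ?thesis
    using assms(1) by (simp add: W_space_def)
qed

text \<open>The bound obtained is the variation itself, read as a real; later arguments then work
  with real partition sums instead of \<open>ennreal\<close>.\<close>

lemma W_spaceE:
  assumes "g \<in> W_space r a b"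
  obtains V where
    "\<And>m t. partition_points a b m t \<Longrightarrow> (\<Sum>i=1..m. \<bar>g (t i) - g (t (i - 1))\<bar> powr r) \<le> V"
proof
  fix m t assume "partition_points a b m t"
  then have "ennreal (\<Sum>i=1..m. \<bar>g (t i) - g (t (i - 1))\<bar> powr r) \<le> r_variation r g a b"
    unfolding r_variation_def by (intro Sup_upper) blast
  moreover have "r_variation r g a b < top"
    using assms by (simp add: W_space_def)
  ultimately have "enn2real (ennreal (\<Sum>i=1..m. \<bar>g (t i) - g (t (i - 1))\<bar> powr r))
      \<le> enn2real (r_variation r g a b)"
    by (rule enn2real_mono)
  then show "(\<Sum>i=1..m. \<bar>g (t i) - g (t (i - 1))\<bar> powr r) \<le> enn2real (r_variation r g a b)"
    by (simp add: sum_nonneg)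
qed

lemma W_space_outside: "g \<in> W_space r a b \<Longrightarrow> x \<notin> {a..b} \<Longrightarrow> g x = 0"
  by (simp add: W_space_def)

lemma W_space_scale:
  assumes "g \<in> W_space r a b"
  shows "(\<lambda>x. c * g x) \<in> W_space r a b"
proof -
  obtain V where V: "(\<Sum>i=1..m. \<bar>g (t i) - g (t (i - 1))\<bar> powr r) \<le> V"
    if "partition_points a b m t" for m t
    using W_spaceE[OF assms] by metis
  show ?thesis
  proof (rule W_spaceI)
    fix m t assume "partition_points a b m t"
    have "(\<Sum>i=1..m. \<bar>c * g (t i) - c * g (t (i - 1))\<bar> powr r)
        = \<bar>c\<bar> powr r * (\<Sum>i=1..m. \<bar>g (t i) - g (t (i - 1))\<bar> powr r)"
      by (simp add: sum_distrib_left abs_mult powr_mult flip: right_diff_distrib)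
    also have "\<dots> \<le> \<bar>c\<bar> powr r * V"
      by (intro mult_left_mono V) (fact | simp)+
    finally show "(\<Sum>i=1..m. \<bar>c * g (t i) - c * g (t (i - 1))\<bar> powr r) \<le> \<bar>c\<bar> powr r * V" .
  qed (simp add: W_space_outside[OF assms])
qed

text \<open>Only finiteness matters, so the convexity bound with its factor
  \<open>2 powr (r - 1)\<close> replaces Minkowski's inequality.\<close>

lemma W_space_add:
  assumes "1 \<le> r" and f: "f \<in> W_space r a b" and g: "g \<in> W_space r a b"
  shows "(\<lambda>x. f x + g x) \<in> W_space r a b"
proof -
  obtain U where U: "(\<Sum>i=1..m. \<bar>f (t i) - f (t (i - 1))\<bar> powr r) \<le> U"
    if "partition_points a b m t" for m t
    using W_spaceE[OF f] by metis
  obtain V where V: "(\<Sum>i=1..m. \<bar>g (t i) - g (t (i - 1))\<bar> powr r) \<le> V"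
    if "partition_points a b m t" for m t
    using W_spaceE[OF g] by metis
  show ?thesis
  proof (rule W_spaceI)
    fix m t assume t: "partition_points a b m t"
    \<comment> \<open>The increment of \<open>g\<close> is reversed to produce the difference that
      \<open>abs_diff_powr_le\<close> expects.\<close>
    have "(\<Sum>i=1..m. \<bar>f (t i) + g (t i) - (f (t (i - 1)) + g (t (i - 1)))\<bar> powr r)
        = (\<Sum>i=1..m. \<bar>(f (t i) - f (t (i - 1))) - (g (t (i - 1)) - g (t i))\<bar> powr r)"
      by (intro sum.cong) (auto simp: algebra_simps)
    also have "\<dots> \<le> (\<Sum>i=1..m. 2 powr (r - 1) *
        (\<bar>f (t i) - f (t (i - 1))\<bar> powr r + \<bar>g (t (i - 1)) - g (t i)\<bar> powr r))"
      by (intro sum_mono abs_diff_powr_le assms)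
    also have "\<dots> = 2 powr (r - 1) * ((\<Sum>i=1..m. \<bar>f (t i) - f (t (i - 1))\<bar> powr r)
        + (\<Sum>i=1..m. \<bar>g (t i) - g (t (i - 1))\<bar> powr r))"
      by (simp add: sum.distrib sum_distrib_left distrib_left abs_minus_commute)
    also have "\<dots> \<le> 2 powr (r - 1) * (U + V)"
      by (intro mult_left_mono add_mono U V t) auto
    finally show "(\<Sum>i=1..m. \<bar>f (t i) + g (t i) - (f (t (i - 1)) + g (t (i - 1)))\<bar> powr r)
        \<le> 2 powr (r - 1) * (U + V)" .
  qed (simp add: W_space_outside[OF f] W_space_outside[OF g])
qed

lemma W_space_zero: "(\<lambda>x. 0) \<in> W_space r a b"
  by (rule W_spaceI[where V = 0]) simp_all

lemma W_space_sum:
  assumes "1 \<le> r" "finite I" "\<And>i. i \<in> I \<Longrightarrow> g i \<in> W_space r a b"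
  shows "(\<lambda>x. \<Sum>i\<in>I. c i * g i x) \<in> W_space r a b"
  using assms(2,3)
proof (induction I rule: finite_induct)
  case empty
  show ?case by (simp add: W_space_zero)
next
  case (insert i I)
  then have "(\<lambda>x. c i * g i x + (\<Sum>j\<in>I. c j * g j x)) \<in> W_space r a b"
    by (intro W_space_add W_space_scale assms(1)) auto
  with insert(1,2) show ?case by simp
qed

text \<open>The variation is bounded by a power \<open>B powr r\<close> so that the root in
  \<open>W_norm\<close> returns \<open>B\<close>.\<close>

lemma W_norm_le:
  assumes "a \<le> b" "0 < r" "0 \<le> B"
    and sup: "\<And>x. x \<in> {a..b} \<Longrightarrow> \<bar>g x\<bar> \<le> A"
    and var: "\<And>m t. partition_points a b m t \<Longrightarrow>
      (\<Sum>i=1..m. \<bar>g (t i) - g (t (i - 1))\<bar> powr r) \<le> B powr r"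
  shows "W_norm r a b g \<le> A + B"
proof -
  have "(SUP t\<in>{a..b}. \<bar>g t\<bar>) \<le> A"
    using assms(1) sup by (intro cSUP_least) auto
  moreover have "r_variation r g a b \<le> ennreal (B powr r)"
    by (intro r_variation_le var)
  then have "enn2real (r_variation r g a b) \<le> B powr r"
    using enn2real_mono[of "r_variation r g a b" "ennreal (B powr r)"] by simp
  then have "enn2real (r_variation r g a b) powr (1 / r) \<le> (B powr r) powr (1 / r)"
    using assms(2) by (intro powr_mono2) auto
  then have "enn2real (r_variation r g a b) powr (1 / r) \<le> B"
    using assms(2,3) by (simp add: powr_powr)
  ultimately show ?thesis
    by (simp add: W_norm_def)
qed

section \<open>Bounded functionals and the dual norm\<close>

lemma W_dual_add:
  assumes "L \<in> W_dual r a b" "f \<in> W_space r a b" "g \<in> W_space r a b"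
  shows "L (\<lambda>x. f x + g x) = L f + L g"
  using assms by (simp add: W_dual_def)

lemma W_dual_scale:
  assumes "L \<in> W_dual r a b" "f \<in> W_space r a b"
  shows "L (\<lambda>x. c * f x) = c * L f"
  using assms by (simp add: W_dual_def)

lemma W_dual_sum:
  assumes "1 \<le> r" and L: "L \<in> W_dual r a b"
    and "finite I" "\<And>i. i \<in> I \<Longrightarrow> g i \<in> W_space r a b"
  shows "L (\<lambda>x. \<Sum>i\<in>I. c i * g i x) = (\<Sum>i\<in>I. c i * L (g i))"
  using assms(3,4)
proof (induction I rule: finite_induct)
  case empty
  show ?case
    using W_dual_scale[OF L W_space_zero, of 0] by simp
next
  case (insert i I)
  then have "L (\<lambda>x. c i * g i x + (\<Sum>j\<in>I. c j * g j x)) = L (\<lambda>x. c i * g i x) + L (\<lambda>x. \<Sum>j\<in>I. c j * g j x)"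
    by (intro W_dual_add[OF L] W_space_scale W_space_sum assms(1)) auto
  with insert show ?case
    by (simp add: W_dual_scale[OF L])
qed

text \<open>The real supremum is controlled only on a bounded set, so finite variation must first be
  shown to bound \<open>g\<close>: \<open>\<bar>g x - g a\<bar> powr r\<close> is the first term of
  a partition sum.\<close>

lemma W_norm_nonneg:
  assumes "a < b" "0 < r" and g: "g \<in> W_space r a b"
  shows "0 \<le> W_norm r a b g"
proof -
  obtain V where V: "(\<Sum>i=1..m. \<bar>g (t i) - g (t (i - 1))\<bar> powr r) \<le> V"
    if "partition_points a b m t" for m t
    using W_spaceE[OF g] by metis
  have "\<bar>g x\<bar> \<le> \<bar>g a\<bar> + V powr (1 / r)" if "x \<in> {a..b}" for x
  proof (cases "x = a")
    case False
    have "\<exists>m t. partition_points a b m t \<and> t 1 = x"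
    proof (cases "x = b")
      case True
      then have "partition_points a b 1 (\<lambda>i. if i = 0 then a else b)"
        using assms(1) by (simp add: partition_points_def)
      with True show ?thesis
        by (intro exI[of _ 1] exI[of _ "\<lambda>i. if i = 0 then a else b"]) simp
    next
      case False
      then have "partition_points a b 2 (\<lambda>i. if i = 0 then a else if i = 1 then x else b)"
        using \<open>x \<noteq> a\<close> that by (auto simp: partition_points_def)
      then show ?thesis
        by (intro exI[of _ 2] exI[of _ "\<lambda>i. if i = 0 then a else if i = 1 then x else b"]) simp
    qed
    then obtain m t where t: "partition_points a b m t" "t 1 = x" by blast
    then have "\<bar>g x - g a\<bar> powr r \<le> (\<Sum>i=1..m. \<bar>g (t i) - g (t (i - 1))\<bar> powr r)"
      using member_le_sum[of 1 "{1..m}" "\<lambda>i. \<bar>g (t i) - g (t (i - 1))\<bar> powr r"]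
      by (simp add: partition_points_def)
    also have "\<dots> \<le> V"
      by (rule V) fact
    finally have "(\<bar>g x - g a\<bar> powr r) powr (1 / r) \<le> V powr (1 / r)"
      using assms(2) by (intro powr_mono2) auto
    then have "\<bar>g x - g a\<bar> \<le> V powr (1 / r)"
      using assms(2) by (simp add: powr_powr)
    then show ?thesis by linarith
  qed auto
  then have "\<bar>g a\<bar> \<le> (SUP t\<in>{a..b}. \<bar>g t\<bar>)"
    using assms(1) by (intro cSUP_upper bdd_aboveI2) auto
  then show ?thesis
    by (simp add: W_norm_def)
qed

text \<open>Continuity of \<open>L\<close> makes the set of values bounded, so the real supremum is
  an upper bound.\<close>

lemma W_dual_norm_upper:
  assumes "a < b" "0 < r" and L: "L \<in> W_dual r a b" and f: "f \<in> W_unit_ball r a b"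
  shows "\<bar>L f\<bar> \<le> W_dual_norm r a b L"
proof -
  obtain C where C: "\<And>f. f \<in> W_space r a b \<Longrightarrow> \<bar>L f\<bar> \<le> C * W_norm r a b f"
    using L unfolding W_dual_def by blast
  \<comment> \<open>The constant in \<open>W_dual\<close> may have any sign, hence
    \<open>\<bar>C\<bar>\<close>.\<close>
  have "\<bar>L f\<bar> \<le> \<bar>C\<bar>" if "f \<in> W_unit_ball r a b" for f
  proof -
    have "\<bar>L f\<bar> \<le> C * W_norm r a b f"
      using C that by (simp add: W_unit_ball_def)
    also have "\<dots> \<le> \<bar>C\<bar> * 1"
      using that W_norm_nonneg[OF assms(1,2)] by (intro mult_mono) (auto simp: W_unit_ball_def)
    finally show ?thesis by simp
  qed
  then show ?thesis
    unfolding W_dual_norm_def using f by (intro cSUP_upper bdd_aboveI2) auto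
qed

text \<open>By homogeneity: dividing \<open>f\<close> by \<open>A + B\<close> puts it into the unit
  ball.\<close>

lemma W_dual_bound:
  assumes "a < b" "0 < r" and L: "L \<in> W_dual r a b" and f: "f \<in> W_space r a b"
    and "0 \<le> A" "0 < B"
    and sup: "\<And>x. x \<in> {a..b} \<Longrightarrow> \<bar>f x\<bar> \<le> A"
    and var: "\<And>m t. partition_points a b m t \<Longrightarrow>
      (\<Sum>i=1..m. \<bar>f (t i) - f (t (i - 1))\<bar> powr r) \<le> B powr r"
  shows "\<bar>L f\<bar> \<le> (A + B) * W_dual_norm r a b L"
proof -
  define s where "s = 1 / (A + B)"
  have s: "0 < s" and s1: "s * A + s * B = 1"
    using assms(5,6) by (auto simp: s_def divide_simps)
  have "W_norm r a b (\<lambda>x. s * f x) \<le> s * A + s * B"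
  proof (rule W_norm_le)
    fix m t assume t: "partition_points a b m t"
    have "(\<Sum>i=1..m. \<bar>s * f (t i) - s * f (t (i - 1))\<bar> powr r)
        = s powr r * (\<Sum>i=1..m. \<bar>f (t i) - f (t (i - 1))\<bar> powr r)"
      using s by (simp add: sum_distrib_left abs_mult powr_mult flip: right_diff_distrib)
    also have "\<dots> \<le> s powr r * B powr r"
      by (intro mult_left_mono var t) auto
    finally show "(\<Sum>i=1..m. \<bar>s * f (t i) - s * f (t (i - 1))\<bar> powr r) \<le> (s * B) powr r"
      using s assms(6) by (simp add: powr_mult)
  qed (use s assms in \<open>auto simp: abs_mult intro!: mult_left_mono\<close>)
  then have "(\<lambda>x. s * f x) \<in> W_unit_ball r a b"
    using s1 W_space_scale[OF f] by (simp add: W_unit_ball_def)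
  then have "\<bar>s * L f\<bar> \<le> W_dual_norm r a b L"
    using W_dual_norm_upper[OF assms(1,2) L] W_dual_scale[OF L f] by metis
  then have "(A + B) * (s * \<bar>L f\<bar>) \<le> (A + B) * W_dual_norm r a b L"
    using s assms(5,6) by (intro mult_left_mono) (auto simp: abs_mult)
  then show ?thesis
    using assms(5,6) by (simp add: s_def)
qed

section \<open>Indicators and the supremum of \<open>T_map a b L\<close>\<close>

text \<open>The indicator is decreasing on \<open>{a..b}\<close> with increments of size 0 or 1, so
  the power drops out and the sum telescopes.\<close>

lemma partition_sum_indicator_le:
  assumes "0 < r" "x \<in> {a..b}" and t: "partition_points a b m t"
  shows "(\<Sum>i=1..m. \<bar>indicat_real {a..x} (t i) - indicat_real {a..x} (t (i - 1))\<bar> powr r) \<le> 1"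
proof -
  let ?g = "indicat_real {a..x}"
  have "\<bar>?g (t i) - ?g (t (i - 1))\<bar> powr r = ?g (t (i - 1)) - ?g (t i)" if "i \<in> {1..m}" for i
  proof -
    have "t (i - 1) \<in> {a..b}" "t (i - 1) \<le> t i"
      using that partition_points_in[OF t, of "i - 1"] partition_points_mono[OF t, of "i - 1" i] by auto
    then show ?thesis
      by (auto simp: indicator_def)
  qed
  then have "(\<Sum>i=1..m. \<bar>?g (t i) - ?g (t (i - 1))\<bar> powr r) = (\<Sum>i=1..m. ?g (t (i - 1)) - ?g (t i))"
    by simp
  also have "\<dots> = (\<Sum>i<m. ?g (t i) - ?g (t (Suc i)))"
    by (rule sum.reindex_bij_witness[of _ Suc "\<lambda>i. i - 1"]) auto
  also have "\<dots> = ?g (t 0) - ?g (t m)"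
    by (rule sum_lessThan_telescope')
  finally show ?thesis
    by (simp add: indicator_def)
qed

lemma indicator_W_space:
  assumes "0 < r" "x \<in> {a..b}"
  shows "indicat_real {a..x} \<in> W_space r a b"
proof (rule W_spaceI)
  fix m t assume "partition_points a b m t"
  then show "(\<Sum>i=1..m. \<bar>indicat_real {a..x} (t i) - indicat_real {a..x} (t (i - 1))\<bar> powr r) \<le> 1"
    by (rule partition_sum_indicator_le[OF assms])
qed (use assms(2) in \<open>auto simp: indicator_def\<close>)

text \<open>An indicator has supremum and variation at most 1, hence the factor
  \<open>1 + 1\<close>.\<close>

lemma T_map_abs_le:
  assumes "a < b" "0 < q" "L \<in> W_dual q a b" "x \<in> {a..b}"
  shows "\<bar>T_map a b L x\<bar> \<le> 2 * W_dual_norm q a b L"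
proof -
  have "\<bar>L (indicat_real {a..x})\<bar> \<le> (1 + 1) * W_dual_norm q a b L"
  proof (rule W_dual_bound[OF assms(1-3) indicator_W_space[OF assms(2,4)]])
    fix m t assume "partition_points a b m t"
    then show "(\<Sum>i=1..m. \<bar>indicat_real {a..x} (t i) - indicat_real {a..x} (t (i - 1))\<bar> powr q) \<le> 1 powr q"
      using partition_sum_indicator_le[OF assms(2,4)] by simp
  qed (auto simp: indicator_def)
  then show ?thesis
    using assms(4) by (simp add: T_map_def)
qed

section \<open>Step functions and the variation of \<open>T_map a b L\<close>\<close>

text \<open>The sum is \<open>L f\<close> for the step function \<open>f\<close> with value
  \<open>c i\<close> on \<open>(t (i - 1), t i]\<close>. The factor 3 is 1 from the supremum of
  \<open>f\<close> plus 2 from its variation.\<close>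

lemma step_test_bound:
  fixes c :: "nat \<Rightarrow> real"
  assumes "a < b" "1 \<le> q" and L: "L \<in> W_dual q a b" and t: "partition_points a b m t"
    and pos: "0 < (\<Sum>i=1..m. \<bar>c i\<bar> powr q)"
  shows "\<bar>\<Sum>i=1..m. c i * (T_map a b L (t i) - T_map a b L (t (i - 1)))\<bar>
    \<le> 3 * (\<Sum>i=1..m. \<bar>c i\<bar> powr q) powr (1 / q) * W_dual_norm q a b L"
proof -
  define C where "C = (\<Sum>i=1..m. \<bar>c i\<bar> powr q)"
  define k where "k x = (LEAST i. x \<le> t i)" for x
  \<comment> \<open>Index 0 is the extra step \<open>{a}\<close>: \<open>k a = 0\<close>, and
    \<open>f a = 0\<close> because every indicator in \<open>g\<close> contains
    \<open>a\<close>.\<close>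
  define d where "d i = (if i = 0 then 0 else c i)" for i
  define g where "g i = (\<lambda>x. indicat_real {a..t i} x + (- 1) * indicat_real {a..t (i - 1)} x)" for i
  define f where "f = (\<lambda>x. \<Sum>i=1..m. c i * g i x)"
  have q: "0 < q" using assms(2) by simp
  have tm: "t m = b"
    using t by (simp add: partition_points_def)
  \<comment> \<open>This adjunction translates comparisons of points into comparisons of step
    indices; the bound and monotonicity of \<open>k\<close> and the values of \<open>g\<close>
    follow from it.\<close>
  have le_iff: "x \<le> t i \<longleftrightarrow> k x \<le> i" if "x \<in> {a..b}" "i \<le> m" for x i
  proof
    assume "k x \<le> i"
    moreover have "x \<le> t (k x)"
      unfolding k_def by (rule LeastI[of _ m]) (use that tm in auto)
    ultimately show "x \<le> t i"
      using partition_points_mono[OF t _ that(2)] by fastforce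
  qed (simp add: k_def Least_le)
  have km: "k x \<le> m" if "x \<in> {a..b}" for x
    using le_iff[OF that, of m] that tm by simp
  have kmono: "k x \<le> k y" if "x \<in> {a..b}" "y \<in> {a..b}" "x \<le> y" for x y
    using le_iff[of x "k y"] le_iff[of y "k y"] km that by fastforce
  have C: "(\<Sum>i\<le>m. \<bar>d i\<bar> powr q) = C"
    unfolding C_def by (rule sum.mono_neutral_cong_right) (auto simp: d_def)
  have fd: "f x = d (k x)" if x: "x \<in> {a..b}" for x
  proof -
    have "g i x = (if i = k x then 1 else 0)" if "i \<in> {1..m}" for i
    proof -
      have "x \<le> t i \<longleftrightarrow> k x \<le> i" "x \<le> t (i - 1) \<longleftrightarrow> k x \<le> i - 1"
        using that by (auto intro!: le_iff[OF x])
      then show ?thesis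
        using x that by (auto simp: g_def indicator_def)
    qed
    then have "f x = (\<Sum>i=1..m. if i = k x then c i else 0)"
      unfolding f_def by (intro sum.cong) auto
    then show ?thesis
      using km[OF x] by (auto simp: d_def)
  qed
  have ind: "indicat_real {a..t i} \<in> W_space q a b" if "i \<le> m" for i
    by (intro indicator_W_space q partition_points_in[OF t that])
  have gW: "g i \<in> W_space q a b" if "i \<in> {1..m}" for i
    unfolding g_def using that by (intro W_space_add W_space_scale ind assms(2)) auto
  have fW: "f \<in> W_space q a b"
    unfolding f_def using gW by (intro W_space_sum assms(2)) auto
  have "L (g i) = T_map a b L (t i) - T_map a b L (t (i - 1))" if "i \<in> {1..m}" for i
  proof -
    have i: "i \<le> m" "i - 1 \<le> m" using that by auto
    have "L (g i) = L (indicat_real {a..t i}) + - 1 * L (indicat_real {a..t (i - 1)})"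
      unfolding g_def
      using W_dual_add[OF L ind[OF i(1)] W_space_scale[OF ind[OF i(2)], of "- 1"]]
        W_dual_scale[OF L ind[OF i(2)], of "- 1"] by simp
    then show ?thesis
      using partition_points_in[OF t i(1)] partition_points_in[OF t i(2)] by (simp add: T_map_def)
  qed
  then have Lf: "L f = (\<Sum>i=1..m. c i * (T_map a b L (t i) - T_map a b L (t (i - 1))))"
    unfolding f_def using gW by (subst W_dual_sum[OF assms(2) L]) auto
  have C0: "0 < C" using pos by (simp add: C_def)
  have "\<bar>L f\<bar> \<le> (C powr (1 / q) + 2 * C powr (1 / q)) * W_dual_norm q a b L"
  proof (rule W_dual_bound[OF assms(1) q L fW])
    fix x assume x: "x \<in> {a..b}"
    have "\<bar>d (k x)\<bar> powr q \<le> C"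
      unfolding C[symmetric] using km[OF x] by (intro member_le_sum) auto
    then have "(\<bar>d (k x)\<bar> powr q) powr (1 / q) \<le> C powr (1 / q)"
      using q by (intro powr_mono2) auto
    then show "\<bar>f x\<bar> \<le> C powr (1 / q)"
      using q by (simp add: powr_powr fd[OF x])
  next
    fix n s assume s: "partition_points a b n s"
    note s_in = partition_points_in[OF s]
    have "(\<Sum>j=1..n. \<bar>f (s j) - f (s (j - 1))\<bar> powr q)
        = (\<Sum>j=1..n. \<bar>d (k (s j)) - d (k (s (j - 1)))\<bar> powr q)"
      by (intro sum.cong) (auto simp: fd[OF s_in])
    also have "\<dots> \<le> 2 powr q * C"
      unfolding C[symmetric]
      by (rule sum_powr_increments_le[where k = "\<lambda>j. k (s j)"])
        (auto intro!: assms(2) km kmono s_in partition_points_mono[OF s])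
    finally show "(\<Sum>j=1..n. \<bar>f (s j) - f (s (j - 1))\<bar> powr q) \<le> (2 * C powr (1 / q)) powr q"
      using q C0 by (simp add: powr_mult powr_powr)
  qed (use C0 in auto)
  then show ?thesis
    by (simp add: Lf C_def)
qed

text \<open>The equality case of Hoelder's inequality: \<open>c\<close> is chosen so that
  \<open>c i * d i\<close> and \<open>\<bar>c i\<bar> powr q\<close> both equal
  \<open>\<bar>d i\<bar> powr p\<close>.\<close>

lemma T_map_partition_sum_le:
  assumes "1 < p" "1 < q" "1 / p + 1 / q = 1" "a < b" and L: "L \<in> W_dual q a b"
    and t: "partition_points a b m t"
  shows "(\<Sum>i=1..m. \<bar>T_map a b L (t i) - T_map a b L (t (i - 1))\<bar> powr p)
    \<le> (3 * W_dual_norm q a b L) powr p"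
proof -
  define d where "d i = T_map a b L (t i) - T_map a b L (t (i - 1))" for i
  define S where "S = (\<Sum>i=1..m. \<bar>d i\<bar> powr p)"
  define c where "c i = sgn (d i) * \<bar>d i\<bar> powr (p - 1)" for i
  have pq: "(p - 1) * q = p"
    using assms(1-3) by (simp add: field_simps)
  have "\<bar>c i\<bar> powr q = \<bar>d i\<bar> powr p" for i
    using assms(1,2) by (simp add: c_def abs_mult sgn_if powr_powr pq)
  then have cS: "(\<Sum>i=1..m. \<bar>c i\<bar> powr q) = S"
    by (simp add: S_def)
  have "c i * d i = \<bar>d i\<bar> powr p" for i
  proof (cases "d i = 0")
    case False
    have "c i * d i = \<bar>d i\<bar> powr (p - 1) * \<bar>d i\<bar> powr 1"
      by (simp add: c_def sgn_if)
    also have "\<dots> = \<bar>d i\<bar> powr p"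
      by (subst powr_add[symmetric]) simp
    finally show ?thesis .
  qed simp
  then have cd: "(\<Sum>i=1..m. c i * d i) = S"
    by (simp add: S_def)
  have "0 \<le> S"
    by (simp add: S_def sum_nonneg)
  \<comment> \<open>For positive \<open>S\<close>, the factor \<open>S powr (1 / q)\<close> can be
    cancelled from the test inequality, leaving \<open>S powr (1 / p)\<close>.\<close>
  then consider "S = 0" | "0 < S" by linarith
  then have "S \<le> (3 * W_dual_norm q a b L) powr p"
  proof cases
    case 2
    have "S \<le> 3 * S powr (1 / q) * W_dual_norm q a b L"
      using step_test_bound[OF assms(4) _ L t, of c] assms(2) 2 unfolding d_def[symmetric] cS cd by simp
    moreover have "S powr (1 / p) * S powr (1 / q) = S"
      using 2 assms(3) by (simp flip: powr_add)
    ultimately have "S powr (1 / p) * S powr (1 / q) \<le> 3 * W_dual_norm q a b L * S powr (1 / q)"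
      by (simp add: mult_ac)
    then have "S powr (1 / p) \<le> 3 * W_dual_norm q a b L"
      using 2 by simp
    then have "(S powr (1 / p)) powr p \<le> (3 * W_dual_norm q a b L) powr p"
      using assms(1) by (intro powr_mono2) auto
    then show ?thesis
      using assms(1) 2 by (simp add: powr_powr)
  qed simp
  then show ?thesis
    by (simp add: S_def d_def)
qed

theorem theorem6:
  fixes a b p q :: real
  assumes "1 < p" and "1 < q" and "1 / p + 1 / q = 1" and "a < b"
  shows "T_map a b \<in> W_dual q a b \<rightarrow> W_space p a b
    \<and> (\<forall>L\<in>W_dual q a b. \<forall>M\<in>W_dual q a b.
          T_map a b (\<lambda>f. L f + M f) = (\<lambda>t. T_map a b L t + T_map a b M t))
    \<and> (\<forall>c::real. \<forall>L\<in>W_dual q a b.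
          T_map a b (\<lambda>f. c * L f) = (\<lambda>t. c * T_map a b L t))
    \<and> (\<forall>L\<in>W_dual q a b. W_norm p a b (T_map a b L) \<le> 5 * W_dual_norm q a b L)"
proof (intro conjI ballI allI Pi_I)
  fix L assume L: "L \<in> W_dual q a b"
  note var = T_map_partition_sum_le[OF assms L]
  have sup: "\<And>x. x \<in> {a..b} \<Longrightarrow> \<bar>T_map a b L x\<bar> \<le> 2 * W_dual_norm q a b L"
    using T_map_abs_le[OF assms(4) _ L] assms(2) by simp
  show "T_map a b L \<in> W_space p a b"
  proof (rule W_spaceI)
    show "T_map a b L x = 0" if "x \<notin> {a..b}" for x
      using that by (auto simp: T_map_def)
  qed (rule var)
  \<comment> \<open>This supplies the sign condition on \<open>B = 3 * W_dual_norm q a b L\<close>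
    in \<open>W_norm_le\<close>.\<close>
  have "0 \<le> W_dual_norm q a b L"
    using sup[of a] assms(4) by simp
  then have "W_norm p a b (T_map a b L) \<le> 2 * W_dual_norm q a b L + 3 * W_dual_norm q a b L"
    by (intro W_norm_le) (use assms(1,4) sup var in simp_all)
  then show "W_norm p a b (T_map a b L) \<le> 5 * W_dual_norm q a b L"
    by simp
\<comment> \<open>Linearity holds pointwise; outside \<open>{a..b}\<close> both sides are zero by
  convention.\<close>
qed (auto simp: T_map_def)

end
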